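(* For any subset $A$ of $\mathbb{R}$, if $\mathbb{R} \setminus A$ is countable and scattered in the real line (i.e. scattered as a subspace of $\mathbb{R}$ with the Euclidean topology), then $H(A)$ is $\sigma$-compact.
   Context: For $A \subseteq \mathbb{R}$, the Hattori space $H(A)$ is the set $\mathbb{R}$ with the topology $\tau(A)$ in which a point $x \in A$ has open neighbourhood basis $\{(x-\epsilon, x+\epsilon) : \epsilon > 0\}$ and a point $x \in \mathbb{R}\setminus A$ has open neighbourhood basis $\{[x, x+\epsilon) : \epsilon > 0\}$. A space is $\sigma$-compact if it is a union of countably many compact subsets. A space is scattered if each of its nonempty subspaces has an isolated point. *)

theory Defs
  imports "HOL-Analysis.Analysis"
begin

text \<open>A set is open iff it contains a basic neighbourhood of each of its points; by
  \<open>openin_hattori_Ioo\<close> and \<open>openin_hattori_Ico\<close> below, the basic neighbourhoods are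
  themselves open.\<close>

definition hattori_topology :: "real set \<Rightarrow> real topology" where
  "hattori_topology A = topology (\<lambda>U.
     (\<forall>x\<in>U \<inter> A. \<exists>\<epsilon>>0. {x - \<epsilon><..<x + \<epsilon>} \<subseteq> U) \<and>
     (\<forall>x\<in>U - A. \<exists>\<epsilon>>0. {x..<x + \<epsilon>} \<subseteq> U))"

lemma istopology_hattori:
  "istopology (\<lambda>U :: real set.
     (\<forall>x\<in>U \<inter> A. \<exists>\<epsilon>>0. {x - \<epsilon><..<x + \<epsilon>} \<subseteq> U) \<and>
     (\<forall>x\<in>U - A. \<exists>\<epsilon>>0. {x..<x + \<epsilon>} \<subseteq> U))"
  (is "istopology ?P")
  unfolding istopology_def
proof (rule conjI; intro allI impI)
  fix U V :: "real set"
  assume U: "?P U" and V: "?P V"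
  show "?P (U \<inter> V)"
  proof (intro conjI ballI)
    fix x assume "x \<in> U \<inter> V \<inter> A"
    with U V obtain d e where "d > 0" "{x - d<..<x + d} \<subseteq> U" "e > 0" "{x - e<..<x + e} \<subseteq> V"
      by (metis IntD1 IntD2 IntI)
    moreover from this have "min d e > 0"
      by simp
    moreover have "{x - min d e<..<x + min d e} \<subseteq> {x - d<..<x + d} \<inter> {x - e<..<x + e}"
      by auto
    ultimately show "\<exists>\<epsilon>>0. {x - \<epsilon><..<x + \<epsilon>} \<subseteq> U \<inter> V"
      by blast
  next
    fix x assume "x \<in> U \<inter> V - A"
    with U V obtain d e where "d > 0" "{x..<x + d} \<subseteq> U" "e > 0" "{x..<x + e} \<subseteq> V"
      by (metis Diff_iff IntD1 IntD2)
    moreover from this have "min d e > 0"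
      by simp
    moreover have "{x..<x + min d e} \<subseteq> {x..<x + d} \<inter> {x..<x + e}"
      by auto
    ultimately show "\<exists>\<epsilon>>0. {x..<x + \<epsilon>} \<subseteq> U \<inter> V"
      by blast
  qed
next
  fix \<K> :: "real set set"
  assume K: "\<forall>U\<in>\<K>. ?P U"
  show "?P (\<Union>\<K>)"
  proof (intro conjI ballI)
    fix x assume "x \<in> \<Union>\<K> \<inter> A"
    then obtain U where "U \<in> \<K>" "x \<in> U \<inter> A"
      by blast
    with K obtain e where "e > 0" "{x - e<..<x + e} \<subseteq> U"
      by meson
    with \<open>U \<in> \<K>\<close> show "\<exists>\<epsilon>>0. {x - \<epsilon><..<x + \<epsilon>} \<subseteq> \<Union>\<K>"
      by blast
  next
    fix x assume "x \<in> \<Union>\<K> - A"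
    then obtain U where "U \<in> \<K>" "x \<in> U - A"
      by blast
    with K obtain e where "e > 0" "{x..<x + e} \<subseteq> U"
      by meson
    with \<open>U \<in> \<K>\<close> show "\<exists>\<epsilon>>0. {x..<x + \<epsilon>} \<subseteq> \<Union>\<K>"
      by blast
  qed
qed

lemma openin_hattori:
  "openin (hattori_topology A) U \<longleftrightarrow>
     (\<forall>x\<in>U \<inter> A. \<exists>\<epsilon>>0. {x - \<epsilon><..<x + \<epsilon>} \<subseteq> U) \<and>
     (\<forall>x\<in>U - A. \<exists>\<epsilon>>0. {x..<x + \<epsilon>} \<subseteq> U)"
  unfolding hattori_topology_def topology_inverse'[OF istopology_hattori] ..

lemma topspace_hattori [simp]: "topspace (hattori_topology A) = UNIV"
proof -
  have "openin (hattori_topology A) UNIV"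
    unfolding openin_hattori by (auto intro: exI[of _ 1])
  then show ?thesis
    using openin_subset by blast
qed

lemma openin_hattori_Ioo: "openin (hattori_topology A) {a<..<b}"
  unfolding openin_hattori
proof (intro conjI ballI)
  fix x assume "x \<in> {a<..<b} \<inter> A"
  then show "\<exists>\<epsilon>>0. {x - \<epsilon><..<x + \<epsilon>} \<subseteq> {a<..<b}"
    by (intro exI[of _ "min (x - a) (b - x)"]) auto
next
  fix x assume "x \<in> {a<..<b} - A"
  then show "\<exists>\<epsilon>>0. {x..<x + \<epsilon>} \<subseteq> {a<..<b}"
    by (intro exI[of _ "b - x"]) auto
qed

lemma openin_hattori_Ico:
  assumes "a \<notin> A"
  shows "openin (hattori_topology A) {a..<b}"
  unfolding openin_hattori
proof (intro conjI ballI)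
  fix x assume "x \<in> {a..<b} \<inter> A"
  with assms have "a < x" "x < b"
    by (auto simp: order.order_iff_strict)
  then show "\<exists>\<epsilon>>0. {x - \<epsilon><..<x + \<epsilon>} \<subseteq> {a..<b}"
    by (intro exI[of _ "min (x - a) (b - x)"]) auto
next
  fix x assume "x \<in> {a..<b} - A"
  then show "\<exists>\<epsilon>>0. {x..<x + \<epsilon>} \<subseteq> {a..<b}"
    by (intro exI[of _ "b - x"]) auto
qed

definition sigma_compact_space :: "'a topology \<Rightarrow> bool" where
  "sigma_compact_space X \<longleftrightarrow>
     (\<exists>\<K>. countable \<K> \<and> (\<forall>K\<in>\<K>. compactin X K) \<and> \<Union>\<K> = topspace X)"

definition scattered_space :: "'a topology \<Rightarrow> bool" where
  "scattered_space X \<longleftrightarrow>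
     (\<forall>S. S \<subseteq> topspace X \<and> S \<noteq> {} \<longrightarrow> (\<exists>x\<in>S. openin (subtopology X S) {x}))"

end

theory Submission
  imports Defs
begin

text \<open>As a subspace of \<open>H(A)\<close>, the set \<open>A\<close> carries the Euclidean topology, and its complement
  is covered by countably many singletons; so it suffices that \<open>A\<close> is an \<open>F\<^sub>\<sigma>\<close> of the line.
  Let \<open>W\<close> be the union of all open \<open>U\<close> such that \<open>A \<inter> U\<close> is \<open>F\<^sub>\<sigma>\<close>; by the Lindelof property
  \<open>A \<inter> W\<close> is \<open>F\<^sub>\<sigma>\<close>. If the complement of \<open>A\<close> were not contained in \<open>W\<close>, its part outside \<open>W\<close>
  would have an isolated point \<open>x\<close>, isolated by an open \<open>V\<close> say. Then \<open>A \<inter> V\<close> is the union of the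
  \<open>F\<^sub>\<sigma>\<close> sets \<open>A \<inter> W \<inter> V\<close> and \<open>V - W - {x}\<close>, so that \<open>x \<in> V \<subseteq> W\<close>. Hence \<open>A\<close> is the
  union of \<open>A \<inter> W\<close> and the closed set \<open>- W\<close>.\<close>

lemma fsigma_in_if_scattered_complement:
  fixes A :: "'a::{metric_space, second_countable_topology} set"
  assumes "scattered_space (subtopology euclidean (- A))"
  shows "fsigma_in euclidean A"
proof -
  define \<U> where "\<U> = {U. open U \<and> fsigma_in euclidean (A \<inter> U)}"
  define W where "W = \<Union>\<U>"
  obtain \<V> where \<V>: "\<V> \<subseteq> \<U>" "countable \<V>" "\<Union>\<V> = W"
    using Lindelof[of \<U>] unfolding \<U>_def W_def by blast
  have "open W"
    unfolding W_def \<U>_def by blast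
  have fsigma_open: "fsigma_in euclidean U" if "open U" for U :: "'a set"
    using that by (simp add: open_imp_fsigma_in metrizable_space_euclidean)
  have fsigma_closed: "fsigma_in euclidean S" if "closed S" for S :: "'a set"
    using that by (simp add: closed_imp_fsigma_in)
  have fsigma_W: "fsigma_in euclidean (A \<inter> W)"
  proof -
    have "fsigma_in euclidean (\<Union>((\<inter>) A ` \<V>))"
      using \<V> by (intro fsigma_in_Union) (auto simp: \<U>_def)
    then show ?thesis
      using \<V>(3) by (simp flip: Int_Union)
  qed
  have "- A \<subseteq> W"
  proof (rule ccontr)
    assume "\<not> - A \<subseteq> W"
    then obtain x where x: "x \<in> - A - W" and
        "openin (subtopology (subtopology euclidean (- A)) (- A - W)) {x}"
      using assms[unfolded scattered_space_def, rule_format, of "- A - W"] by auto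
    then obtain V where "open V" and V: "{x} = V \<inter> (- A - W)"
      unfolding subtopology_subtopology openin_subtopology by (metis Int_Diff Int_absorb open_openin)
    have "fsigma_in euclidean ((A \<inter> W \<inter> V) \<union> ((- W) \<inter> (V - {x})))"
      using \<open>open V\<close> \<open>open W\<close>
      by (intro fsigma_in_Un fsigma_in_Int fsigma_W fsigma_open[of V] fsigma_open[of "V - {x}"]
          fsigma_closed[of "- W"]) auto
    \<comment> \<open>Outside \<open>W\<close>, the only point of \<open>V\<close> not in
      \<open>A\<close> is \<open>x\<close>.\<close>
    moreover have "(A \<inter> W \<inter> V) \<union> ((- W) \<inter> (V - {x})) = A \<inter> V"
      using V x by blast
    ultimately have "V \<in> \<U>"
      using \<open>open V\<close> by (simp add: \<U>_def)
    then show False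
      using V unfolding W_def by blast
  qed
  then have "A = A \<inter> W \<union> - W"
    by blast
  moreover have "fsigma_in euclidean (A \<inter> W \<union> - W)"
    using \<open>open W\<close> by (intro fsigma_in_Un fsigma_W fsigma_closed) auto
  ultimately show ?thesis
    by simp
qed

text \<open>Points of \<open>A\<close> have Euclidean basic neighbourhoods, so the inclusion of the
  Euclidean subspace \<open>A\<close> into the Hattori space is continuous and preserves
  compactness.\<close>

lemma compactin_hattori:
  assumes "compact K" "K \<subseteq> A"
  shows "compactin (hattori_topology A) K"
proof -
  have "continuous_map (subtopology euclidean A) (hattori_topology A) id"
    unfolding continuous_map_def
  proof (intro conjI allI impI)
    fix U assume U: "openin (hattori_topology A) U"
    have "A \<inter> interior U = A \<inter> U"
    proof (intro equalityI subsetI IntI)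
      fix x assume x: "x \<in> A \<inter> U"
      with U obtain e where "e > 0" "{x - e<..<x + e} \<subseteq> U"
        unfolding openin_hattori by blast
      then show "x \<in> interior U"
        by (intro interiorI[of "{x - e<..<x + e}"]) auto
    qed (use interior_subset in auto)
    then show "openin (subtopology euclidean A) {x \<in> topspace (subtopology euclidean A). id x \<in> U}"
      by (auto simp: openin_open intro!: exI[of _ "interior U"])
  qed auto
  moreover have "compactin (subtopology euclidean A) K"
    using assms by (simp add: compactin_subtopology)
  ultimately show ?thesis
    using image_compactin by fastforce
qed

text \<open>Each closed piece is cut by closed balls of natural radius about a fixed point;
  Heine-Borel makes the cuts compact.\<close>

lemma fsigma_in_imp_sigma_compact:
  fixes S :: "'a::heine_borel set"
  assumes "fsigma_in euclidean S"
  shows "\<exists>\<K>. countable \<K> \<and> (\<forall>K\<in>\<K>. compact K) \<and> \<Union>\<K> = S"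
proof -
  obtain \<C> where \<C>: "countable \<C>" "\<forall>C\<in>\<C>. closed C" "\<Union>\<C> = S"
    using assms unfolding fsigma_in_def union_of_def closed_closedin by blast
  fix a :: 'a
  define \<K> where "\<K> = (\<lambda>(C, n). C \<inter> cball a (real n)) ` (\<C> \<times> UNIV)"
  have "countable \<K>"
    unfolding \<K>_def using \<C>(1) by simp
  moreover have "compact K" if "K \<in> \<K>" for K
    using that \<C>(2) by (auto simp: \<K>_def intro: closed_Int_compact)
  moreover have "\<Union>\<K> = S"
  proof (intro equalityI subsetI)
    fix x assume "x \<in> S"
    then obtain C where "C \<in> \<C>" "x \<in> C"
      using \<C>(3) by blast
    moreover obtain n where "dist a x \<le> real n"
      using real_arch_simple by blast
    ultimately show "x \<in> \<Union>\<K>"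
      unfolding \<K>_def by force
  qed (use \<C>(3) in \<open>auto simp: \<K>_def\<close>)
  ultimately show ?thesis
    by blast
qed

theorem corollary2p1:
  fixes A :: "real set"
  assumes "countable (UNIV - A)"
    and "scattered_space (subtopology euclideanreal (UNIV - A))"
  shows "sigma_compact_space (hattori_topology A)"
proof -
  have "fsigma_in euclidean A"
    using assms(2) by (simp add: fsigma_in_if_scattered_complement Compl_eq_Diff_UNIV)
  then obtain \<K> where \<K>: "countable \<K>" "\<forall>K\<in>\<K>. compact K" "\<Union>\<K> = A"
    using fsigma_in_imp_sigma_compact by blast
  show ?thesis
    unfolding sigma_compact_space_def
  proof (intro exI[of _ "\<K> \<union> (\<lambda>x. {x}) ` (UNIV - A)"] conjI ballI)
    show "countable (\<K> \<union> (\<lambda>x. {x}) ` (UNIV - A))"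
      using \<K>(1) assms(1) by simp
    show "compactin (hattori_topology A) K" if "K \<in> \<K> \<union> (\<lambda>x. {x}) ` (UNIV - A)" for K
    proof (cases "K \<in> \<K>")
      case True
      with \<K>(2,3) show ?thesis
        by (intro compactin_hattori) auto
    next
      case False
      with that show ?thesis
        by auto
    qed
    show "\<Union>(\<K> \<union> (\<lambda>x. {x}) ` (UNIV - A)) = topspace (hattori_topology A)"
      using \<K>(3) by auto
  qed
qed

end
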